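(* Let $G$ be a $2$-tough $2K_2$-free graph with at least three vertices. Then $G$ is Hamiltonian, i.e., $G$ contains a cycle passing through all vertices of $G$.
   Context: All graphs are finite, simple and undirected. $\omega(H)$ denotes the number of connected components of a graph $H$. A graph $G$ is $t$-tough if $|S| \geq t\cdot \omega(G-S)$ for every subset $S\subset V(G)$ with $\omega(G-S)>1$. A graph is $2K_2$-free if it does not contain $2K_2$ (the graph on four vertices consisting of two independent edges) as an induced subgraph. *)

theory Defs
  imports Complex_Main
begin

definition simple_graph :: "'a set \<Rightarrow> ('a \<Rightarrow> 'a \<Rightarrow> bool) \<Rightarrow> bool" where
  "simple_graph V E \<longleftrightarrow> finite V \<and> (\<forall>x y. E x y \<longrightarrow> x \<in> V \<and> y \<in> V)
     \<and> (\<forall>x y. E x y \<longrightarrow> E y x) \<and> (\<forall>x. \<not> E x x)"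

definition reach_in :: "('a \<Rightarrow> 'a \<Rightarrow> bool) \<Rightarrow> 'a set \<Rightarrow> 'a \<Rightarrow> 'a \<Rightarrow> bool" where
  "reach_in E W = (\<lambda>x y. E x y \<and> x \<in> W \<and> y \<in> W)\<^sup>*\<^sup>*"

definition components_in :: "('a \<Rightarrow> 'a \<Rightarrow> bool) \<Rightarrow> 'a set \<Rightarrow> 'a set set" where
  "components_in E W = {{y \<in> W. reach_in E W x y} | x. x \<in> W}"

definition num_components :: "'a set \<Rightarrow> ('a \<Rightarrow> 'a \<Rightarrow> bool) \<Rightarrow> 'a set \<Rightarrow> nat" where
  "num_components V E S = card (components_in E (V - S))"

definition tough :: "real \<Rightarrow> 'a set \<Rightarrow> ('a \<Rightarrow> 'a \<Rightarrow> bool) \<Rightarrow> bool" where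
  "tough t V E \<longleftrightarrow> (\<forall>S. S \<subset> V \<and> num_components V E S > 1 \<longrightarrow>
      real (card S) \<ge> t * real (num_components V E S))"

definition twoK2_free :: "'a set \<Rightarrow> ('a \<Rightarrow> 'a \<Rightarrow> bool) \<Rightarrow> bool" where
  "twoK2_free V E \<longleftrightarrow> \<not> (\<exists>a b c d. a \<in> V \<and> b \<in> V \<and> c \<in> V \<and> d \<in> V \<and>
      distinct [a, b, c, d] \<and> E a b \<and> E c d \<and>
      \<not> E a c \<and> \<not> E a d \<and> \<not> E b c \<and> \<not> E b d)"

definition hamiltonian :: "'a set \<Rightarrow> ('a \<Rightarrow> 'a \<Rightarrow> bool) \<Rightarrow> bool" where
  "hamiltonian V E \<longleftrightarrow> (\<exists>vs. distinct vs \<and> set vs = V \<and> length vs \<ge> 3 \<and>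
      (\<forall>i < length vs - 1. E (vs ! i) (vs ! Suc i)) \<and> E (last vs) (hd vs))"

end

theory Submission
  imports Defs
begin

text \<open>
  Let \<open>n\<close> be the number of vertices. By 2-toughness an independent set has at most \<open>n/3\<close>
  elements, and since the common non-neighbours of an edge are independent, the vertices of
  degree at most \<open>n/3 - 1\<close> (the low ones) form an independent set. Toughness and Hall's theorem
  give disjoint stars \<open>K\<^bsub>1,2\<^esub>\<close> centred at the low vertices, hence a cyclic arrangement of all
  vertices in which consecutive non-adjacent pairs (gaps) never involve a low vertex. Take one
  with the fewest gaps and suppose there is a gap \<open>b, a\<close>; cut it to get a path from \<open>a\<close> to \<open>b\<close>.
  By rotation, predecessors of neighbours of \<open>a\<close> are not adjacent to \<open>b\<close>. If two of these
  predecessors \<open>x, y\<close> are adjacent, two further Hamiltonian paths ending in \<open>b\<close>, starting at \<open>x\<close>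
  and at its successor \<open>x'\<close>, show that the edge \<open>xx'\<close> has at least \<open>deg b\<close> common
  non-neighbours, which is too many. Otherwise these predecessors together with \<open>b\<close> form an
  independent set of size \<open>deg a + 1 > n/3\<close>.
\<close>

section \<open>Hall's theorem\<close>

text \<open>Halmos-Vaughan induction. If a nonempty proper subfamily \<open>K\<close> is tight, it
  is matched on its own, and the remaining sets are matched after removing the union over
  \<open>K\<close>. If none is tight, every nonempty proper subfamily has an element to spare, so
  any \<open>x\<close> in \<open>A i\<close> can be given to \<open>i\<close>.\<close>

lemma hall:
  fixes A :: "'i \<Rightarrow> 'a set"
  assumes "finite I"
    and "\<And>i. i \<in> I \<Longrightarrow> finite (A i)"
    and "\<And>J. J \<subseteq> I \<Longrightarrow> card J \<le> card (\<Union>(A ` J))"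
  shows "\<exists>R. inj_on R I \<and> (\<forall>i\<in>I. R i \<in> A i)"
  using assms
proof (induction "card I" arbitrary: I A rule: less_induct)
  case less
  note finI = less.prems(1) and finA = less.prems(2) and hallc = less.prems(3)
  have finU: "finite (\<Union>(A ` J))" if "J \<subseteq> I" for J
    using finA finI that by (meson finite_UN finite_subset subsetD)
  show ?case
  proof (cases "I = {}")
    case True
    then show ?thesis by simp
  next
    case False
    show ?thesis
    proof (cases "\<exists>K. K \<subset> I \<and> K \<noteq> {} \<and> card (\<Union>(A ` K)) = card K")
      case True
      then obtain K where K: "K \<subset> I" "K \<noteq> {}" "card (\<Union>(A ` K)) = card K"
        by blast
      have finK: "finite K"
        using K(1) finI finite_subset by blast
      have "\<exists>R. inj_on R K \<and> (\<forall>i\<in>K. R i \<in> A i)"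
      proof (rule less.hyps)
        show "card K < card I" using K(1) finI psubset_card_mono by blast
      qed (use K finK finA hallc in auto)
      then obtain R where R: "inj_on R K" "\<forall>i\<in>K. R i \<in> A i" by blast
      define B where "B i = A i - \<Union>(A ` K)" for i
      have "\<exists>R. inj_on R (I - K) \<and> (\<forall>i\<in>I - K. R i \<in> B i)"
      proof (rule less.hyps)
        show "card (I - K) < card I"
          using K finI by (intro psubset_card_mono) auto
        show "finite (I - K)" using finI by simp
        show "finite (B i)" if "i \<in> I - K" for i
          using that finA by (simp add: B_def)
        fix J assume J: "J \<subseteq> I - K"
        have finJ: "finite J" using J finI finite_subset by blast
        have "card J + card K = card (J \<union> K)"
          using J finJ finK by (subst card_Un_disjoint) auto
        also have "\<dots> \<le> card (\<Union>(A ` (J \<union> K)))"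
          using J K by (intro hallc) auto
        also have "\<Union>(A ` (J \<union> K)) = \<Union>(B ` J) \<union> \<Union>(A ` K)"
          by (auto simp: B_def)
        also have "card \<dots> \<le> card (\<Union>(B ` J)) + card (\<Union>(A ` K))"
          by (rule card_Un_le)
        finally show "card J \<le> card (\<Union>(B ` J))"
          using K(3) by simp
      qed
      then obtain Q where Q: "inj_on Q (I - K)" "\<forall>i\<in>I - K. Q i \<in> B i" by blast
      define T where "T i = (if i \<in> K then R i else Q i)" for i
      have "T i \<in> A i" if "i \<in> I" for i
        using that R(2) Q(2) by (auto simp: T_def B_def)
      moreover have "T i \<noteq> T j" if "i \<in> I" "j \<in> I" "i \<noteq> j" for i j
      proof -
        have *: "R k \<noteq> Q l" if "k \<in> K" "l \<in> I - K" for k l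
          using R(2) Q(2) that by (auto simp: B_def)
        show ?thesis
          using that *[of i j] *[of j i, symmetric] inj_onD[OF R(1), of i j] inj_onD[OF Q(1), of i j]
          by (cases "i \<in> K"; cases "j \<in> K") (auto simp: T_def)
      qed
      ultimately show ?thesis
        by (intro exI[of _ T]) (auto simp: inj_on_def)
    next
      case no_tight: False
      obtain i where i: "i \<in> I" using False by blast
      have "card {i} \<le> card (\<Union>(A ` {i}))" using i by (intro hallc) auto
      then obtain x where x: "x \<in> A i" by fastforce
      define B where "B j = A j - {x}" for j
      have "\<exists>R. inj_on R (I - {i}) \<and> (\<forall>j\<in>I - {i}. R j \<in> B j)"
      proof (rule less.hyps)
        show "card (I - {i}) < card I" using i finI by (meson card_Diff1_less)
        show "finite (I - {i})" using finI by simp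
        show "finite (B j)" if "j \<in> I - {i}" for j
          using that finA by (simp add: B_def)
        fix J assume J: "J \<subseteq> I - {i}"
        show "card J \<le> card (\<Union>(B ` J))"
        proof (cases "J = {}")
          case False
          have "J \<subset> I" using J i by blast
          then have "card J \<noteq> card (\<Union>(A ` J))"
            using no_tight False by metis
          moreover have "card J \<le> card (\<Union>(A ` J))"
            using J by (intro hallc) auto
          moreover have "\<Union>(B ` J) = \<Union>(A ` J) - {x}"
            by (auto simp: B_def)
          ultimately show ?thesis
            using finU[of J] \<open>J \<subset> I\<close> by (auto simp: card_Diff_singleton_if)
        qed simp
      qed
      then obtain R where R: "inj_on R (I - {i})" "\<forall>j\<in>I - {i}. R j \<in> B j" by blast
      have "inj_on (R(i := x)) I"
        using R i by (auto simp: inj_on_def B_def)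
      moreover have "\<forall>j\<in>I. (R(i := x)) j \<in> A j"
        using R(2) x by (auto simp: B_def)
      ultimately show ?thesis by blast
    qed
  qed
qed

section \<open>Counting gaps in an arrangement\<close>

text \<open>Only pairs inside the list count; the pair that closes the cycle is treated separately
  in \<open>cyclic_gaps\<close>.\<close>

fun gaps :: "('a \<Rightarrow> 'a \<Rightarrow> bool) \<Rightarrow> 'a list \<Rightarrow> nat" where
  "gaps E (x # y # zs) = (if E x y then 0 else 1) + gaps E (y # zs)"
| "gaps E zs = 0"

lemma gaps_append:
  "us \<noteq> [] \<Longrightarrow> ws \<noteq> [] \<Longrightarrow>
    gaps E (us @ ws) = gaps E us + gaps E ws + (if E (last us) (hd ws) then 0 else 1)"
proof (induction us rule: induct_list012)
  case (2 x)
  then show ?case by (cases ws) auto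
qed auto

lemma gaps_rev: "(\<And>x y. E x y = E y x) \<Longrightarrow> gaps E (rev us) = gaps E us"
proof (induction us)
  case (Cons x us)
  then show ?case
    by (cases "us = []") (auto simp: gaps_append last_rev neq_Nil_conv)
qed simp

lemma successively_split_or:
  "successively P vs \<or> (\<exists>us ws. vs = us @ ws \<and> us \<noteq> [] \<and> ws \<noteq> [] \<and> \<not> P (last us) (hd ws))"
proof (induction vs)
  case (Cons x vs)
  show ?case
  proof (cases "vs = [] \<or> P x (hd vs)")
    case True
    from Cons show ?thesis
    proof
      assume "\<exists>us ws. vs = us @ ws \<and> us \<noteq> [] \<and> ws \<noteq> [] \<and> \<not> P (last us) (hd ws)"
      then obtain us ws where "vs = us @ ws" "us \<noteq> []" "ws \<noteq> []" "\<not> P (last us) (hd ws)"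
        by blast
      then have "x # vs = (x # us) @ ws" "x # us \<noteq> []" "ws \<noteq> []" "\<not> P (last (x # us)) (hd ws)"
        by auto
      then show ?thesis by blast
    qed (use True in \<open>auto simp: successively_Cons\<close>)
  next
    case False
    then have "x # vs = [x] @ vs" "[x] \<noteq> []" "vs \<noteq> []" "\<not> P (last [x]) (hd vs)"
      by auto
    then show ?thesis by blast
  qed
qed simp

section \<open>Independent sets\<close>

locale tough_2K2_free =
  fixes V :: "'a set" and E :: "'a \<Rightarrow> 'a \<Rightarrow> bool"
  assumes simple: "simple_graph V E"
    and tough: "tough 2 V E"
    and free: "twoK2_free V E"
    and card_V: "card V \<ge> 3"
begin

lemma finite_V: "finite V"
  and edge_V: "E x y \<Longrightarrow> x \<in> V \<and> y \<in> V"
  and edge_sym: "E x y = E y x"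
  and edge_irrefl: "\<not> E x x"
  using simple unfolding simple_graph_def by blast+

definition nbrs :: "'a \<Rightarrow> 'a set" where
  "nbrs v = {u. E v u}"

lemma nbrs_subset: "nbrs v \<subseteq> V"
  using edge_V by (auto simp: nbrs_def)

lemma finite_nbrs: "finite (nbrs v)"
  using nbrs_subset finite_V finite_subset by blast

definition independent :: "'a set \<Rightarrow> bool" where
  "independent T \<longleftrightarrow> T \<subseteq> V \<and> (\<forall>x\<in>T. \<forall>y\<in>T. \<not> E x y)"

lemma independentI: "T \<subseteq> V \<Longrightarrow> (\<And>x y. x \<in> T \<Longrightarrow> y \<in> T \<Longrightarrow> \<not> E x y) \<Longrightarrow> independent T"
  by (auto simp: independent_def)

lemma finite_components_in: "finite W \<Longrightarrow> finite (components_in E W)"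
  unfolding components_in_def by simp

lemma isolated_component:
  assumes "x \<in> W" and "nbrs x \<inter> W = {}"
  shows "{y \<in> W. reach_in E W x y} = {x}"
proof -
  have "y = x" if "reach_in E W x y" for y
    using that unfolding reach_in_def
  proof (cases rule: converse_rtranclpE)
    case (step z)
    then show ?thesis using assms(2) by (auto simp: nbrs_def)
  qed simp
  then show ?thesis
    using assms(1) by (auto simp: reach_in_def)
qed

text \<open>Each vertex of \<open>T\<close> is a whole component once \<open>S\<close> is removed.
  Toughness speaks only when there are two components; \<open>rest\<close> supplies the second one,
  either within \<open>T\<close> or around a vertex outside both \<open>T\<close> and
  \<open>S\<close>.\<close>

lemma two_isolated_le:
  assumes "T \<subseteq> V" and "S \<subset> V" and "T \<inter> S = {}"
    and nb: "\<And>x. x \<in> T \<Longrightarrow> nbrs x \<subseteq> S"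
    and rest: "card T \<ge> 2 \<or> (T \<noteq> {} \<and> T \<noteq> V - S)"
  shows "2 * card T \<le> card S"
proof -
  let ?W = "V - S"
  have TW: "T \<subseteq> ?W" using assms by blast
  have fin: "finite (components_in E ?W)"
    using finite_V by (intro finite_components_in) auto
  have iso: "{y \<in> ?W. reach_in E ?W x y} = {x}" if "x \<in> T" for x
    using that TW nb[OF that] by (intro isolated_component) auto
  have sub: "(\<lambda>x. {x}) ` T \<subseteq> components_in E ?W"
    unfolding components_in_def using iso TW by blast
  have cardT: "card ((\<lambda>x. {x}) ` T) = card T"
    by (simp add: card_image)
  have le: "card T \<le> num_components V E S"
    unfolding num_components_def using card_mono[OF fin sub] cardT by simp
  have "num_components V E S > 1"
  proof (cases "card T \<ge> 2")
    case True
    then show ?thesis using le by simp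
  next
    case False
    then obtain t z where t: "t \<in> T" and z: "z \<in> ?W" "z \<notin> T"
      using rest TW by blast
    have "{y \<in> ?W. reach_in E ?W z y} \<in> components_in E ?W"
      unfolding components_in_def using z by blast
    moreover have "{t} \<in> components_in E ?W" using sub t by blast
    moreover have "z \<in> {y \<in> ?W. reach_in E ?W z y}"
      using z by (simp add: reach_in_def)
    ultimately have "card {{t}, {y \<in> ?W. reach_in E ?W z y}} \<le> card (components_in E ?W)"
      using fin by (intro card_mono) auto
    moreover have "{t} \<noteq> {y \<in> ?W. reach_in E ?W z y}"
      using \<open>z \<in> {y \<in> ?W. reach_in E ?W z y}\<close> z t by auto
    ultimately show ?thesis
      by (simp add: num_components_def)
  qed
  then have "real (card S) \<ge> 2 * real (num_components V E S)"
    using tough assms(2) unfolding tough_def by blast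
  then show ?thesis using le by linarith
qed

lemma card_independent_le:
  assumes "independent T"
  shows "3 * card T \<le> card V"
proof (cases "card T \<ge> 2")
  case True
  have T: "T \<subseteq> V" using assms by (simp add: independent_def)
  have "T \<noteq> {}" using True by auto
  have "2 * card T \<le> card (V - T)"
  proof (rule two_isolated_le)
    show "V - T \<subset> V" using T \<open>T \<noteq> {}\<close> by blast
    show "nbrs x \<subseteq> V - T" if "x \<in> T" for x
      using that assms nbrs_subset by (auto simp: independent_def nbrs_def)
  qed (use T True in auto)
  moreover have "card (V - T) = card V - card T"
    using T finite_V finite_subset by (intro card_Diff_subset) auto
  moreover have "card T \<le> card V" using T finite_V card_mono by blast
  ultimately show ?thesis by linarith
next
  case False
  then show ?thesis using card_V by linarith
qed

text \<open>Removing the neighbourhood isolates \<open>T\<close>. The factor 2 makes this Hall's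
  condition for giving every vertex of \<open>T\<close> two private neighbours.\<close>

lemma two_card_le_nbrs:
  assumes "independent T"
  shows "2 * card T \<le> card (\<Union>(nbrs ` T))"
proof (cases "T = {}")
  case False
  let ?S = "\<Union>(nbrs ` T)"
  have T: "T \<subseteq> V" using assms by (simp add: independent_def)
  have disj: "T \<inter> ?S = {}"
    using assms by (auto simp: independent_def nbrs_def)
  have SV: "?S \<subset> V"
    using nbrs_subset T disj False by blast
  show ?thesis
  proof (cases "card T \<ge> 2 \<or> T \<noteq> V - ?S")
    case True
    then show ?thesis
      using T SV disj False by (intro two_isolated_le) auto
  next
    \<comment> \<open>Only one vertex survives the removal, so toughness says nothing; but then all
      other vertices, at least two, are its neighbours.\<close>
    case eq: False
    have "finite T" using T finite_V finite_subset by blast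
    then have "card T = 1" using eq False by (metis One_nat_def Suc_leI card_gt_0_iff le_antisym not_less_eq_eq numeral_2_eq_2)
    moreover have "V = T \<union> ?S" using eq SV by blast
    then have "card V = card T + card ?S"
      using disj finite_V by (metis card_Un_disjoint finite_Un)
    ultimately show ?thesis using card_V by linarith
  qed
qed simp

section \<open>Common non-neighbours of an edge, and low vertices\<close>

definition nonnbrs :: "'a \<Rightarrow> 'a \<Rightarrow> 'a set" where
  "nonnbrs x y = {v \<in> V. \<not> E x v \<and> \<not> E y v}"

text \<open>The non-neighbours of an edge stay independent when one of its ends is added.\<close>

lemma card_nonnbrs_le:
  assumes "E x y"
  shows "3 * card (nonnbrs x y) + 3 \<le> card V"
proof -
  have xy: "x \<in> V" "y \<in> V" "x \<noteq> y" using assms edge_V edge_irrefl by blast+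
  have "x \<notin> nonnbrs x y" "y \<notin> nonnbrs x y"
    using assms edge_sym by (auto simp: nonnbrs_def)
  have "\<not> E u v" if uv: "u \<in> nonnbrs x y" "v \<in> nonnbrs x y" for u v
  proof
    assume "E u v"
    then have "distinct [x, y, u, v]"
      using uv xy \<open>x \<notin> nonnbrs x y\<close> \<open>y \<notin> nonnbrs x y\<close> edge_irrefl by auto
    then show False
      using free uv xy assms \<open>E u v\<close> unfolding twoK2_free_def nonnbrs_def by blast
  qed
  moreover have "\<not> E x u" "\<not> E u x" if "u \<in> nonnbrs x y" for u
    using that edge_sym[of u x] by (simp_all add: nonnbrs_def)
  moreover have "insert x (nonnbrs x y) \<subseteq> V"
    using xy by (auto simp: nonnbrs_def)
  ultimately have "independent (insert x (nonnbrs x y))"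
    using edge_irrefl by (intro independentI) blast+
  from card_independent_le[OF this] show ?thesis
    using \<open>x \<notin> nonnbrs x y\<close> finite_V by (simp add: nonnbrs_def)
qed

definition low :: "'a set" where
  "low = {v \<in> V. 3 * card (nbrs v) + 3 \<le> card V}"

text \<open>For an edge between low \<open>x\<close> and \<open>y\<close>, the sets
  \<open>nonnbrs x y\<close>, \<open>nbrs x\<close> and \<open>nbrs y\<close> would cover
  \<open>V\<close>, yet each has at most a third of \<open>card V\<close> minus one
  elements.\<close>

lemma low_independent: "independent low"
proof (rule independentI)
  show "low \<subseteq> V" by (auto simp: low_def)
  fix x y assume xy: "x \<in> low" "y \<in> low"
  show "\<not> E x y"
  proof
    assume "E x y"
    have "V \<subseteq> nonnbrs x y \<union> (nbrs x \<union> nbrs y)"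
      by (auto simp: nonnbrs_def nbrs_def)
    then have "card V \<le> card (nonnbrs x y \<union> (nbrs x \<union> nbrs y))"
      using finite_V finite_nbrs by (intro card_mono) (auto simp: nonnbrs_def)
    also have "\<dots> \<le> card (nonnbrs x y) + (card (nbrs x) + card (nbrs y))"
      by (meson add_left_mono card_Un_le order_trans)
    finally show False
      using card_nonnbrs_le[OF \<open>E x y\<close>] xy by (simp add: low_def)
  qed
qed

section \<open>Arrangements\<close>

text \<open>Both ends of a gap are high, so cutting a cycle at a gap leaves a path whose two ends
  satisfy the degree bound.\<close>

definition link :: "'a \<Rightarrow> 'a \<Rightarrow> bool" where
  "link x y \<longleftrightarrow> E x y \<or> x \<notin> low \<and> y \<notin> low"

lemma link_sym: "link x y = link y x"
  using edge_sym by (auto simp: link_def)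

lemma link_edge: "E x y \<Longrightarrow> link x y"
  by (simp add: link_def)

definition arrangement :: "'a list \<Rightarrow> bool" where
  "arrangement vs \<longleftrightarrow> distinct vs \<and> set vs = V \<and> successively link vs"

lemma arrangement_nonempty: "arrangement vs \<Longrightarrow> vs \<noteq> []"
  using card_V by (auto simp: arrangement_def)

lemma link_rev: "successively link (rev us) = successively link us"
  using link_sym by (simp add: successively_rev)

lemma gaps_E_rev: "gaps E (rev us) = gaps E us"
  using edge_sym by (rule gaps_rev)

lemma arrangement_exists:
  "\<exists>vs. arrangement vs \<and> hd vs \<notin> low \<and> last vs \<notin> low"
proof -
  have finL: "finite low" using finite_V by (simp add: low_def)
  \<comment> \<open>The Boolean makes two copies of each low vertex, so distinct representatives are
    two private neighbours for each.\<close>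
  have "\<exists>R. inj_on R (low \<times> (UNIV :: bool set)) \<and> (\<forall>i\<in>low \<times> UNIV. R i \<in> nbrs (fst i))"
  proof (rule hall)
    fix J :: "('a \<times> bool) set" assume J: "J \<subseteq> low \<times> UNIV"
    have "finite (fst ` J)" using J finL by (meson finite_subset finite_SigmaI finite_imageI finite)
    have "card J \<le> card (fst ` J \<times> (UNIV :: bool set))"
      using \<open>finite (fst ` J)\<close> by (intro card_mono) (force intro: finite_SigmaI)+
    also have "\<dots> = 2 * card (fst ` J)"
      by (simp add: card_cartesian_product card_UNIV_bool)
    also have "\<dots> \<le> card (\<Union>(nbrs ` fst ` J))"
    proof (rule two_card_le_nbrs)
      have "fst ` J \<subseteq> low" using J by auto
      then show "independent (fst ` J)"
        using low_independent unfolding independent_def by blast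
    qed
    finally show "card J \<le> card (\<Union>((\<lambda>i. nbrs (fst i)) ` J))"
      by (simp add: image_image)
  qed (use finL finite_nbrs in auto)
  then obtain R where R: "inj_on R (low \<times> (UNIV :: bool set))"
    "\<And>l c. l \<in> low \<Longrightarrow> R (l, c) \<in> nbrs l" by fastforce
  have leaf: "R (l, c) \<in> V - low" "E l (R (l, c))" if "l \<in> low" for l c
    using R(2)[OF that, of c] that low_independent nbrs_subset
    by (auto simp: independent_def nbrs_def)
  have eq: "R (l, c) = R (l', c') \<longleftrightarrow> l = l' \<and> c = c'" if "l \<in> low" "l' \<in> low" for l l' c c'
    using inj_onD[OF R(1), of "(l, c)" "(l', c')"] that by auto
  \<comment> \<open>A star is listed as leaf, centre, leaf. Leaves are high because
    \<open>low\<close> is independent, so stars can be concatenated in any order without breaking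
    \<open>link\<close>.\<close>
  define star where "star l = [R (l, False), l, R (l, True)]" for l
  have set_star: "set (star l) = {R (l, False), l, R (l, True)}" for l
    by (auto simp: star_def)
  have leaf_neq: "R (l, c) \<noteq> l'" if "l \<in> low" "l' \<in> low" for l l' c
    using leaf(1)[OF that(1), of c] that(2) by blast
  have star_disjoint: "set (star l) \<inter> set (star l') = {}"
    if "l \<in> low" "l' \<in> low" "l \<noteq> l'" for l l'
    using that eq leaf_neq leaf_neq[symmetric] by (simp add: set_star)
  have stars: "distinct (concat (map star ls)) \<and> successively link (concat (map star ls)) \<and>
      (ls \<noteq> [] \<longrightarrow> hd (concat (map star ls)) \<notin> low \<and> last (concat (map star ls)) \<notin> low)"
    if "distinct ls" "set ls \<subseteq> low" for ls
    using that
  proof (induction ls)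
    case (Cons l ls)
    then have l: "l \<in> low" "l \<notin> set ls" "set ls \<subseteq> low" by auto
    have "set (star l) \<inter> set (concat (map star ls)) = {}"
      using l star_disjoint[OF l(1)] by (simp add: disjoint_iff) (metis subsetD)
    moreover have "distinct (star l)"
      using l(1) eq leaf_neq leaf_neq[symmetric] by (simp add: star_def)
    moreover have "successively link (star l)"
      using leaf[OF l(1)] edge_sym by (auto simp: star_def intro!: link_edge)
    moreover have "hd (star l) \<notin> low" "last (star l) \<notin> low" "star l \<noteq> []"
      using leaf[OF l(1)] by (auto simp: star_def)
    moreover have "link (last (star l)) (hd (concat (map star ls)))" if "ls \<noteq> []"
      using Cons.IH Cons.prems that \<open>last (star l) \<notin> low\<close> by (simp add: link_def)
    moreover have "concat (map star ls) \<noteq> []" if "ls \<noteq> []"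
      using that by (auto simp: neq_Nil_conv star_def)
    ultimately show ?case
      using Cons by (cases "ls = []") (simp_all add: successively_append_iff)
  qed simp
  obtain ls where ls: "distinct ls" "set ls = low"
    using finite_distinct_list[OF finL] by blast
  define S where "S = concat (map star ls)"
  have S: "distinct S" "successively link S" "S \<noteq> [] \<Longrightarrow> hd S \<notin> low \<and> last S \<notin> low"
    using stars[of ls] ls unfolding S_def by auto
  have low_S: "low \<subseteq> set S" "set S \<subseteq> V"
    using ls leaf by (auto simp: S_def star_def low_def)
  \<comment> \<open>The vertices outside the stars are all high, so they may follow in any
    order.\<close>
  obtain ws where ws: "distinct ws" "set ws = V - set S"
    using finite_distinct_list[of "V - set S"] finite_V by blast
  have wslow: "x \<notin> low" if "x \<in> set ws" for x
    using that ws low_S by blast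
  have "successively link ws"
    using wslow by (auto simp: successively_conv_nth link_def)
  then have arr: "arrangement (S @ ws)"
    using S ws low_S wslow hd_in_set[of ws]
    by (auto simp: arrangement_def successively_append_iff link_def)
  moreover have "hd (S @ ws) \<notin> low" "last (S @ ws) \<notin> low"
    using S(3) wslow arrangement_nonempty[OF arr]
    by (auto simp: hd_append last_append)
  ultimately show ?thesis by blast
qed

section \<open>Rotations of an arrangement\<close>

text \<open>The Posa rotation: the pair \<open>last us\<close>, \<open>hd ws\<close> is exchanged
  for the edge \<open>hd us\<close>, \<open>hd ws\<close>, and all other pairs stay
  consecutive.\<close>

lemma reverse_prefix:
  assumes arr: "arrangement (us @ ws)" and ne: "us \<noteq> []" "ws \<noteq> []"
    and e: "E (hd us) (hd ws)"
  shows "arrangement (rev us @ ws)"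
    and "gaps E (us @ ws) = gaps E (rev us @ ws) + (if E (last us) (hd ws) then 0 else 1)"
proof -
  show "arrangement (rev us @ ws)"
    using arr ne link_edge[OF e]
    by (simp add: arrangement_def successively_append_iff link_rev last_rev del: successively_rev)
  show "gaps E (us @ ws) = gaps E (rev us @ ws) + (if E (last us) (hd ws) then 0 else 1)"
    using ne e by (simp add: gaps_append gaps_E_rev last_rev)
qed

text \<open>The rotated arrangement starts at \<open>last us\<close> and still ends at
  \<open>last ws\<close>, so such an edge would close it.\<close>

lemma no_closing:
  assumes nc: "\<And>vs. arrangement vs \<Longrightarrow> gaps E vs \<le> c \<Longrightarrow> \<not> E (last vs) (hd vs)"
    and arr: "arrangement (us @ ws)" and c: "gaps E (us @ ws) \<le> c"
    and ne: "us \<noteq> []" "ws \<noteq> []" and e: "E (hd us) (hd ws)"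
  shows "\<not> E (last us) (last ws)"
proof -
  have "gaps E (rev us @ ws) \<le> c"
    using reverse_prefix(2)[OF arr ne e] c by linarith
  from nc[OF reverse_prefix(1)[OF arr ne e] this] show ?thesis
    using ne edge_sym[of "last us"] by (simp add: hd_rev)
qed

lemma no_closing_nth:
  assumes nc: "\<And>vs. arrangement vs \<Longrightarrow> gaps E vs \<le> c \<Longrightarrow> \<not> E (last vs) (hd vs)"
    and arr: "arrangement vs" and c: "gaps E vs \<le> c"
    and k: "Suc k < length vs" and e: "E (last vs) (vs ! k)"
  shows "\<not> E (hd vs) (vs ! Suc k)"
proof
  let ?us = "take (Suc k) vs" and ?ws = "drop (Suc k) vs"
  assume "E (hd vs) (vs ! Suc k)"
  then have "E (hd ?us) (hd ?ws)" using k by (simp add: hd_drop_conv_nth)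
  moreover have "last ?us = vs ! k" "last ?ws = last vs"
    using k by (simp_all add: take_Suc_conv_app_nth)
  ultimately show False
    using no_closing[OF nc, where us = ?us and ws = ?ws] arr c k e edge_sym[of "last vs" "vs ! k"] by force
qed

text \<open>\<open>nc\<close> and \<open>nv\<close> are what minimality says after a cycle is cut at
  a gap: \<open>c\<close> gaps are too few for a closed cycle, and fewer than \<open>c\<close> are
  too few even if the closing pair of high ends is one more gap.\<close>

lemma closed_arrangement_contradiction:
  assumes nc: "\<And>vs. arrangement vs \<Longrightarrow> gaps E vs \<le> c \<Longrightarrow> \<not> E (last vs) (hd vs)"
    and nv: "\<And>vs. arrangement vs \<Longrightarrow> gaps E vs < c \<Longrightarrow> hd vs \<in> low \<or> last vs \<in> low"
    and arr: "arrangement vs" and c: "gaps E vs \<le> c"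
    and high: "hd vs \<notin> low" "last vs \<notin> low"
  shows False
proof -
  let ?a = "hd vs" and ?b = "last vs" and ?n = "length vs"
  have vs: "distinct vs" "set vs = V" "vs \<noteq> []"
    using arr arrangement_nonempty[OF arr] by (simp_all add: arrangement_def)
  have a: "?a \<in> V" "?b \<in> V"
    using hd_in_set[OF vs(3)] last_in_set[OF vs(3)] vs(2) by simp_all
  have nab: "\<not> E ?a ?b" using nc[OF arr c] by (simp add: edge_sym[of ?a])
  \<comment> \<open>The pair just before a neighbour of \<open>?a\<close> is an actual edge:
    otherwise \<open>last us\<close> is high, and the rotation has fewer gaps and two high ends,
    against \<open>nv\<close>.\<close>
  have real: "E (last us) (hd ws)" and endp: "\<not> E (last us) ?b"
    if "vs = us @ ws" "us \<noteq> []" "ws \<noteq> []" "E ?a (hd ws)" for us ws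
  proof -
    have arr': "arrangement (us @ ws)" and e: "E (hd us) (hd ws)" using that arr by auto
    note rp = reverse_prefix[OF arr' that(2,3) e]
    show "E (last us) (hd ws)"
    proof (rule ccontr)
      assume n: "\<not> E (last us) (hd ws)"
      have "link (last us) (hd ws)"
        using arr' that by (auto simp: arrangement_def successively_append_iff)
      then have "last us \<notin> low" using n by (simp add: link_def)
      moreover have "gaps E (rev us @ ws) < c" using rp(2) n c that(1) by simp
      ultimately show False
        using nv[OF rp(1)] high that by (auto simp: hd_rev)
    qed
    show "\<not> E (last us) ?b"
      using no_closing[OF nc arr' _ that(2,3) e] c that by simp
  qed
  have chord: "\<not> E (last A) (last M)"
    if split: "vs = A @ M @ B" and ne: "A \<noteq> []" "M \<noteq> []" "B \<noteq> []"
      and eM: "E ?a (hd M)" and eB: "E ?a (hd B)" for A M B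
  proof
    assume xy: "E (last A) (last M)"
    have hdA: "?a = hd A" and eM': "E (hd A) (hd M)" and eB': "E (hd A) (hd B)"
      using split ne eM eB by auto
    have e1: "E (last A) (hd M)" "\<not> E (last A) ?b"
      using real[of A "M @ B"] endp[of A "M @ B"] split ne eM by auto
    have e2: "E (last M) (hd B)" "\<not> E (last M) ?b"
      using real[of "A @ M" B] endp[of "A @ M" B] split ne eB by auto
    \<comment> \<open>\<open>P\<close> is the rotation at \<open>hd M\<close>. \<open>T\<close> runs
      through \<open>M\<close>, takes the supposed edge to \<open>last A\<close>, returns to
      \<open>?a\<close> and jumps to \<open>B\<close>. Their first vertices are the two ends of the
      edge from \<open>last A\<close> to \<open>hd M\<close>.\<close>
    define P where "P = rev A @ M @ B"
    define T where "T = M @ rev A @ B"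
    have "arrangement (A @ M @ B)" "E (hd A) (hd (M @ B))"
      using arr split ne eM' by auto
    note rp = reverse_prefix[OF this(1) ne(1) _ this(2)]
    have arrP: "arrangement P" unfolding P_def using rp(1) ne by simp
    have cP: "gaps E P \<le> c" using rp(2) ne c split by (simp add: P_def)
    have linked: "successively link A" "successively link M" "successively link B"
      using arr split by (auto simp: arrangement_def successively_append_iff)
    have arrT: "arrangement T"
    proof -
      have "link (last M) (last A)" "link (hd A) (hd B)"
        using link_edge[OF xy] link_edge[OF eB'] link_sym by auto
      then have "successively link T"
        using linked ne
        by (simp add: T_def successively_append_iff link_rev hd_rev last_rev del: successively_rev)
      moreover have "distinct T" "set T = V"
        using vs(1) unfolding vs(2)[symmetric] by (auto simp: T_def split)
      ultimately show ?thesis by (simp add: arrangement_def)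
    qed
    \<comment> \<open>Two junctions are replaced by two others, and all four are edges by
      \<open>e1\<close>, \<open>e2\<close>, \<open>xy\<close> and \<open>eB'\<close>.\<close>
    have "gaps E T = gaps E vs"
      using split ne xy eB' e1 e2 edge_sym
      by (simp add: T_def gaps_append gaps_E_rev hd_rev last_rev)
    then have cT: "gaps E T \<le> c" using c by simp
    have lenP: "length P = ?n" and setP: "distinct P" "set P = V" "last P = ?b"
      using split vs ne by (auto simp: P_def)
    have lenT: "length T = ?n" and lastT: "last T = ?b"
      using split ne by (auto simp: T_def)
    have "hd P = last A" "hd T = hd M" using ne by (simp_all add: P_def T_def hd_rev)
    then have avoidP: "\<not> E (last A) (P ! Suc k)" if "Suc k < ?n" "E ?b (P ! k)" for k
      using no_closing_nth[OF nc arrP cP, of k] that lenP setP(3) by simp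
    have avoidT: "\<not> E (hd M) (T ! Suc k)" if "Suc k < ?n" "E ?b (T ! k)" for k
      using no_closing_nth[OF nc arrT cT, of k] that lenT lastT \<open>hd T = hd M\<close> by simp
    text \<open>\<^term>\<open>P\<close> and \<^term>\<open>T\<close> have the same successor relation except at \<^term>\<open>?a\<close> and
      \<^term>\<open>last M\<close>, neither of which is a neighbour of \<^term>\<open>?b\<close>. So the successor along
      \<^term>\<open>P\<close> of each neighbour of \<^term>\<open>?b\<close> misses both ends of the edge from
      \<^term>\<open>last A\<close> to \<^term>\<open>hd M\<close>, which leaves too many common non-neighbours.\<close>
    have avoidM: "\<not> E (hd M) (P ! Suc k)" if k: "Suc k < ?n" "E ?b (P ! k)" for k
    proof -
      let ?A = "length A" and ?M = "length M"
      have n: "?n = ?A + ?M + length B" using split by simp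
      have "Suc k \<noteq> ?A"
      proof
        assume "Suc k = ?A"
        then have "P ! k = last (rev A)"
          using ne by (simp add: P_def nth_append last_conv_nth flip: \<open>Suc k = ?A\<close>)
        then show False using k(2) nab ne edge_sym[of ?b ?a] by (simp add: last_rev flip: hdA)
      qed
      moreover have "Suc k \<noteq> ?A + ?M"
      proof
        assume *: "Suc k = ?A + ?M"
        then have "P ! k = M ! (k - ?A)" "k - ?A = ?M - 1"
          using ne by (auto simp: P_def nth_append)
        then have "P ! k = last M" using ne by (simp add: last_conv_nth)
        then show False using k(2) e2 edge_sym[of ?b "last M"] by simp
      qed
      \<comment> \<open>Within a block, passing from \<open>P\<close> to \<open>T\<close> moves
        \<open>rev A\<close> up by \<open>?M\<close>, moves \<open>M\<close> down by
        \<open>?A\<close>, and fixes \<open>B\<close>.\<close>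
      ultimately consider "Suc k < ?A" | "?A \<le> k" "Suc k < ?A + ?M" | "?A + ?M \<le> k"
        by linarith
      then show ?thesis
      proof cases
        case 1
        then have "P ! k = T ! (?M + k)" "P ! Suc k = T ! Suc (?M + k)"
          by (auto simp: P_def T_def nth_append)
        then show ?thesis using avoidT[of "?M + k"] k 1 n by simp
      next
        case 2
        then have "P ! k = T ! (k - ?A)" "P ! Suc k = T ! Suc (k - ?A)"
          by (auto simp: P_def T_def nth_append Suc_diff_le)
        then show ?thesis using avoidT[of "k - ?A"] k 2 n by simp
      next
        case 3
        then have "P ! k = T ! k" "P ! Suc k = T ! Suc k"
          by (auto simp: P_def T_def nth_append add.commute)
        then show ?thesis using avoidT[of k] k by simp
      qed
    qed
    \<comment> \<open>As \<open>?b\<close> comes last in \<open>P\<close>, each of its neighbours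
      has a successor, and successors at distinct positions are distinct.\<close>
    define K where "K = {k. Suc k < ?n \<and> E ?b (P ! k)}"
    have "nbrs ?b \<subseteq> (!) P ` K"
    proof
      fix q assume "q \<in> nbrs ?b"
      then have q: "E ?b q" by (simp add: nbrs_def)
      then obtain k where k: "k < ?n" "P ! k = q"
        using edge_V setP lenP by (metis in_set_conv_nth)
      have "k \<noteq> ?n - 1"
        using k q setP(3) lenP edge_irrefl arrangement_nonempty[OF arrP] by (metis last_conv_nth)
      then show "q \<in> (!) P ` K" using k q by (auto simp: K_def)
    qed
    moreover have finK: "finite K" by (rule finite_subset[of _ "{..<?n}"]) (auto simp: K_def)
    ultimately have "card (nbrs ?b) \<le> card K"
      by (meson card_image_le card_mono finite_imageI order_trans)
    also have "\<dots> = card ((\<lambda>k. P ! Suc k) ` K)"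
      using setP(1) lenP by (intro card_image[symmetric]) (auto simp: inj_on_def K_def nth_eq_iff_index_eq)
    also have "\<dots> \<le> card (nonnbrs (last A) (hd M))"
      using avoidP avoidM setP(2) lenP finite_V
      by (intro card_mono) (auto simp: nonnbrs_def K_def dest: nth_mem)
    finally show False
      using card_nonnbrs_le[OF e1(1)] high(2) a by (simp add: low_def)
  qed
  \<comment> \<open>Now the positions of predecessors of neighbours of \<open>?a\<close>. Since
    \<open>?a\<close> sits at position 0, every neighbour has a predecessor; the bound on
    \<open>Suc k\<close> keeps \<open>?b\<close> out.\<close>
  define K where "K = {k. Suc k < ?n \<and> E ?a (vs ! Suc k)}"
  have finK: "finite K" by (rule finite_subset[of _ "{..<?n}"]) (auto simp: K_def)
  have "nbrs ?a \<subseteq> (\<lambda>k. vs ! Suc k) ` K"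
  proof
    fix q assume "q \<in> nbrs ?a"
    then have q: "E ?a q" by (simp add: nbrs_def)
    then obtain k where k: "k < ?n" "vs ! k = q"
      using edge_V vs by (metis in_set_conv_nth)
    have "k \<noteq> 0" using k q vs edge_irrefl by (metis hd_conv_nth)
    then show "q \<in> (\<lambda>k. vs ! Suc k) ` K"
      using k q by (intro image_eqI[of _ _ "k - 1"]) (auto simp: K_def)
  qed
  then have degK: "card (nbrs ?a) \<le> card K"
    using finK by (meson card_image_le card_mono finite_imageI order_trans)
  have cardI: "card ((!) vs ` K) = card K"
    using vs(1) by (intro card_image) (auto simp: inj_on_def K_def nth_eq_iff_index_eq)
  have bnot: "?b \<notin> (!) vs ` K"
    using vs by (auto simp: K_def last_conv_nth nth_eq_iff_index_eq)
  have nb: "\<not> E (vs ! k) ?b" if "k \<in> K" for k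
    using endp[of "take (Suc k) vs" "drop (Suc k) vs"] that vs
    by (auto simp: K_def hd_drop_conv_nth last_conv_nth)
  have nKless: "\<not> E (vs ! k) (vs ! l)" if kl: "k \<in> K" "l \<in> K" "k < l" for k l
  proof -
    have k: "Suc k < ?n" "Suc l < ?n" "E ?a (vs ! Suc k)" "E ?a (vs ! Suc l)"
      using kl by (auto simp: K_def)
    \<comment> \<open>Cutting after positions \<open>k\<close> and \<open>l\<close> produces the
      three blocks for \<open>chord\<close>; \<open>k < l\<close> makes the middle one
      nonempty.\<close>
    let ?A = "take (Suc k) vs" and ?M = "drop (Suc k) (take (Suc l) vs)" and ?B = "drop (Suc l) vs"
    have "?A @ ?M = take (Suc l) vs"
      using append_take_drop_id[of "Suc k" "take (Suc l) vs"] kl(3) by (simp add: min_def)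
    then have "vs = ?A @ ?M @ ?B"
      using append_take_drop_id[of "Suc l" vs] by (metis append.assoc)
    moreover have "?M \<noteq> []" "hd ?M = vs ! Suc k" "last ?M = vs ! l" "last ?A = vs ! k"
        "hd ?B = vs ! Suc l" "?A \<noteq> []" "?B \<noteq> []"
      using k kl(3) vs by (auto simp: hd_drop_conv_nth last_conv_nth)
    ultimately show ?thesis
      using chord[of ?A ?M ?B] k by metis
  qed
  have nK: "\<not> E (vs ! k) (vs ! l)" if "k \<in> K" "l \<in> K" for k l
    using nKless[of k l] nKless[of l k] that edge_sym[of "vs ! k" "vs ! l"] edge_irrefl
    by (cases k l rule: linorder_cases) auto
  have "independent (insert ?b ((!) vs ` K))"
  proof (rule independentI)
    show "insert ?b ((!) vs ` K) \<subseteq> V" using a vs(2) by (auto simp: K_def)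
    have "\<not> E ?b (vs ! k)" if "k \<in> K" for k
      using nb[OF that] edge_sym by blast
    then show "\<not> E x y" if "x \<in> insert ?b ((!) vs ` K)" "y \<in> insert ?b ((!) vs ` K)" for x y
      using that nb nK edge_irrefl by blast
  qed
  from card_independent_le[OF this] have "3 * (card K + 1) \<le> card V"
    using bnot finK cardI by simp
  then show False
    using degK high(1) a by (simp add: low_def)
qed

section \<open>Cyclic arrangements with the fewest gaps\<close>

definition cyclic_gaps :: "'a list \<Rightarrow> nat" where
  "cyclic_gaps vs = gaps E vs + (if E (last vs) (hd vs) then 0 else 1)"

lemma cyclic_gaps_swap:
  "us \<noteq> [] \<Longrightarrow> ws \<noteq> [] \<Longrightarrow> cyclic_gaps (ws @ us) = cyclic_gaps (us @ ws)"
  by (simp add: cyclic_gaps_def gaps_append)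

lemma hamiltonian: "hamiltonian V E"
proof -
  define cyc where "cyc vs \<longleftrightarrow> arrangement vs \<and> link (last vs) (hd vs)" for vs
  have "\<exists>vs. cyc vs" using arrangement_exists by (auto simp: cyc_def link_def)
  then obtain vs where vs: "cyc vs" and min: "\<And>us. cyc us \<Longrightarrow> cyclic_gaps vs \<le> cyclic_gaps us"
    using ex_has_least_nat[of cyc _ cyclic_gaps] by blast
  \<comment> \<open>Applied to cyclic shifts of \<open>vs\<close> whose closing pair is a gap: there
    \<open>gaps E us\<close> is one less than the minimum, which yields both assumptions on
    \<open>c\<close>.\<close>
  have nomore: False if arr: "arrangement us" and lk: "link (last us) (hd us)"
      and n: "\<not> E (last us) (hd us)" and eq: "cyclic_gaps us = cyclic_gaps vs" for us
  proof (rule closed_arrangement_contradiction[of "gaps E us" us])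
    have g: "cyclic_gaps vs = gaps E us + 1" using eq n by (simp add: cyclic_gaps_def)
    show "\<not> E (last xs) (hd xs)" if "arrangement xs" "gaps E xs \<le> gaps E us" for xs
      using min[of xs] that g by (auto simp: cyc_def link_def cyclic_gaps_def)
    show "hd xs \<in> low \<or> last xs \<in> low" if "arrangement xs" "gaps E xs < gaps E us" for xs
    proof (rule ccontr)
      assume "\<not> (hd xs \<in> low \<or> last xs \<in> low)"
      then have "cyc xs" using that by (simp add: cyc_def link_def)
      from min[OF this] show False
        using that g by (simp add: cyclic_gaps_def[of xs] split: if_splits)
    qed
    show "hd us \<notin> low" "last us \<notin> low" using lk n by (auto simp: link_def)
  qed (use arr in auto)
  have arr: "arrangement vs" and lk: "link (last vs) (hd vs)" using vs by (auto simp: cyc_def)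
  have closed: "E (last vs) (hd vs)" using nomore[OF arr lk] by blast
  have "successively E vs"
  proof (rule ccontr)
    assume "\<not> successively E vs"
    then obtain us ws where s: "vs = us @ ws" "us \<noteq> []" "ws \<noteq> []" "\<not> E (last us) (hd ws)"
      using successively_split_or by blast
    \<comment> \<open>Shifting the cycle moves the inner gap to the closing position.\<close>
    have "arrangement (ws @ us)"
      using arr lk s by (auto simp: arrangement_def successively_append_iff)
    moreover have "link (last us) (hd ws)"
      using arr s by (auto simp: arrangement_def successively_append_iff)
    ultimately show False
      using nomore[of "ws @ us"] s cyclic_gaps_swap[of us ws] by simp
  qed
  then show ?thesis
    using arr closed card_V distinct_card[of vs] unfolding hamiltonian_def
    by (intro exI[of _ vs]) (auto simp: arrangement_def successively_conv_nth)
qed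

end

theorem theorem7:
  fixes V :: "'a set" and E :: "'a \<Rightarrow> 'a \<Rightarrow> bool"
  assumes "simple_graph V E"
    and "tough 2 V E"
    and "twoK2_free V E"
    and "card V \<ge> 3"
  shows "hamiltonian V E"
  using assms by (intro tough_2K2_free.hamiltonian) (simp add: tough_2K2_free_def)

end
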